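(* For the self-sewing of the Riemann sphere described by $z(z'-w)=\rho$, the torus modular parameter is $q=f(\chi)$, where $f$ is the Catalan series and $\chi=-\rho/w^2$.
   Context: Let $\mathcal{S}_0=\mathbb{C}\cup\{\infty\}$ be the Riemann sphere and $w\in\mathbb{C}$, $w\neq0$. Choose local coordinates $z_1=z$ near the origin and $z_2=z'-w$ for $z'$ near $w$. For $\rho\in\mathbb{C}$, $0<|\rho|\le r_1r_2$, identify the annuli $|\rho|r_2^{-1}\le|z|\le r_1$ and $|\rho|r_1^{-1}\le|z'-w|\le r_2$ via the sewing relation $z(z'-w)=\rho$; the discs $|z|<|\rho|r_2^{-1}$ and $|z'-w|<|\rho|r_1^{-1}$ are excised. The annuli do not intersect provided $|w|>r_1+r_2$ (so $|w|>2|\rho|^{1/2}$). The result is a torus, whose modular parameter $q=\exp(2\pi i\tau)$ has $\tau=\Omega^{(1)}_{11}=\frac1{2\pi i}\oint_b\nu$, where $\nu$ is the holomorphic 1-form with $\oint_a\nu=2\pi i$, the $a$-cycle is an anticlockwise contour about $z'=w$ in the second annulus, and the $b$-cycle is a path from $z_1=z_0$ to the identified point $z_2=\rho/z_0$. With $\chi=-\rho/w^2$ one has $0<|\chi|<\frac14$. The Catalan series is the series $$f(\chi)=\frac{1-\sqrt{1-4\chi}}{2\chi}-1=\sum_{n\ge1}\frac1n\binom{2n}{n+1}\chi^n,$$ convergent for $|\chi|<\frac14$ and satisfying $\chi=\frac{f}{(1+f)^2}$. *)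

theory Defs
  imports "HOL-Complex_Analysis.Complex_Analysis"
begin

text \<open>
  Self-sewing of the Riemann sphere. Points are described by the affine coordinate of the
  sphere; the point at infinity is treated through the coordinate \<open>t = 1/z\<close>.
  The excised discs are open and the annuli closed, so that for \<open>\<bar>\<rho>\<bar> = r1 r2\<close> the annuli
  degenerate to circles.
\<close>

definition annulus1 :: "complex \<Rightarrow> real \<Rightarrow> real \<Rightarrow> complex set" where
  "annulus1 \<rho> r1 r2 = {z. cmod \<rho> / r2 \<le> cmod z \<and> cmod z \<le> r1}"

definition annulus2 :: "complex \<Rightarrow> complex \<Rightarrow> real \<Rightarrow> real \<Rightarrow> complex set" where
  "annulus2 \<rho> w r1 r2 = {z'. cmod \<rho> / r1 \<le> cmod (z' - w) \<and> cmod (z' - w) \<le> r2}"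

definition cut_plane :: "complex \<Rightarrow> complex \<Rightarrow> real \<Rightarrow> real \<Rightarrow> complex set" where
  "cut_plane \<rho> w r1 r2 =
     UNIV - ({z. cmod z < cmod \<rho> / r2} \<union> {z'. cmod (z' - w) < cmod \<rho> / r1})"

definition sewing_map :: "complex \<Rightarrow> complex \<Rightarrow> complex \<Rightarrow> complex" where
  "sewing_map \<rho> w z = w + \<rho> / z"

text \<open>The solution \<open>z'\<close> of the sewing relation \<open>z (z' - w) = \<rho>\<close>:\<close>

lemma sewing_relation_iff:
  assumes "z \<noteq> 0"
  shows "z * (z' - w) = \<rho> \<longleftrightarrow> z' = sewing_map \<rho> w z"
  using assms by (auto simp: sewing_map_def field_simps)

text \<open>
  A holomorphic 1-form on the sewn surface, given by its expression \<open>g(z) dz\<close> in the affine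
  coordinate of the sphere:
  (1) \<open>g\<close> is holomorphic on the sphere with the two discs removed. \<open>analytic_on\<close> means
      holomorphic in a neighbourhood of each point of this closed set: a boundary point is an
      interior point of the sewn surface, and there \<open>z\<close> (or \<open>z'\<close>) continues across the boundary
      to a local coordinate of the surface. Values of \<open>g\<close> further inside the discs are irrelevant.
  (2) In the coordinate \<open>t = 1/z\<close> the form is \<open>- g(1/t) / t\<^sup>2 dt\<close>, holomorphic at \<open>t = 0\<close>.
  (3) The expressions at identified points \<open>z\<close>, \<open>z'\<close> agree: \<open>g(z) dz = g(z') dz'\<close>, the right-hand
      side being pulled back along the identification.
\<close>

definition holomorphic_form_on_sewn ::
    "complex \<Rightarrow> complex \<Rightarrow> real \<Rightarrow> real \<Rightarrow> (complex \<Rightarrow> complex) \<Rightarrow> bool" where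
  "holomorphic_form_on_sewn \<rho> w r1 r2 g \<longleftrightarrow>
     g analytic_on cut_plane \<rho> w r1 r2 \<and>
     (\<exists>h. h analytic_on {0} \<and> (\<forall>\<^sub>F t in at 0. h t = - g (1 / t) / t\<^sup>2)) \<and>
     (\<forall>z \<in> annulus1 \<rho> r1 r2.
        g z = g (sewing_map \<rho> w z) * deriv (sewing_map \<rho> w) z)"

definition a_cycle ::
    "complex \<Rightarrow> complex \<Rightarrow> real \<Rightarrow> real \<Rightarrow> (real \<Rightarrow> complex) \<Rightarrow> bool" where
  "a_cycle \<rho> w r1 r2 a \<longleftrightarrow>
     valid_path a \<and> pathfinish a = pathstart a \<and>
     path_image a \<subseteq> annulus2 \<rho> w r1 r2 \<and> winding_number a w = 1"

text \<open>
  A path in the cut sphere from \<open>z\<^sub>0\<close> to the point \<open>z' = w + \<rho>/z\<^sub>0\<close> it is identified with, i.e.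
  a closed curve on the sewn surface.
\<close>

definition b_cycle ::
    "complex \<Rightarrow> complex \<Rightarrow> real \<Rightarrow> real \<Rightarrow> (real \<Rightarrow> complex) \<Rightarrow> bool" where
  "b_cycle \<rho> w r1 r2 b \<longleftrightarrow>
     valid_path b \<and> path_image b \<subseteq> cut_plane \<rho> w r1 r2 \<and>
     pathstart b \<in> annulus1 \<rho> r1 r2 \<and>
     pathfinish b = sewing_map \<rho> w (pathstart b)"

text \<open>
  \<open>\<tau>\<close> depends on the choice of the \<open>b\<close>-cycle up to an integer, hence the period is a relation.
\<close>

definition sewn_torus_period ::
    "complex \<Rightarrow> complex \<Rightarrow> real \<Rightarrow> real \<Rightarrow> complex \<Rightarrow> bool" where
  "sewn_torus_period \<rho> w r1 r2 \<tau> \<longleftrightarrow>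
     (\<exists>\<nu> a b. holomorphic_form_on_sewn \<rho> w r1 r2 \<nu> \<and>
        a_cycle \<rho> w r1 r2 a \<and> b_cycle \<rho> w r1 r2 b \<and>
        contour_integral a \<nu> = 2 * of_real pi * \<i> \<and>
        \<tau> = 1 / (2 * of_real pi * \<i>) * contour_integral b \<nu>)"

definition sewn_torus_modular_parameter ::
    "complex \<Rightarrow> complex \<Rightarrow> real \<Rightarrow> real \<Rightarrow> complex \<Rightarrow> bool" where
  "sewn_torus_modular_parameter \<rho> w r1 r2 q \<longleftrightarrow>
     (\<exists>\<tau>. sewn_torus_period \<rho> w r1 r2 \<tau> \<and> q = exp (2 * of_real pi * \<i> * \<tau>))"

text \<open>
  \<open>f(x) = \<Sum>\<^sub>n\<^sub>\<ge>\<^sub>1 1/n (2n choose n+1) x\<^sup>n\<close>, with the summation index shifted to start from 0.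
\<close>

definition catalan_series :: "complex \<Rightarrow> complex" where
  "catalan_series x =
     (\<Sum>n. 1 / of_nat (Suc n) * of_nat ((2 * Suc n) choose (Suc n + 1)) * x ^ Suc n)"

end

theory Submission
  imports Defs
begin

text \<open>
  Sewing identifies \<open>z\<close> with \<open>\<sigma>(z) = w + \<rho>/z\<close>, a Moebius map. Its fixed points \<open>\<alpha>\<close> and \<open>\<beta>\<close> are the
  roots of \<open>z\<^sup>2 - w z - \<rho>\<close>, so \<open>\<alpha> + \<beta> = w\<close> and \<open>\<alpha> \<beta> = -\<rho>\<close>; when \<open>\<bar>\<alpha>\<bar> \<le> \<bar>\<beta>\<bar>\<close>, the size conditions on
  \<open>r1\<close>, \<open>r2\<close> and \<open>w\<close> put \<open>\<alpha>\<close> into the disc excised at 0 and \<open>\<beta>\<close> into the disc excised at \<open>w\<close>. In the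
  coordinate \<open>u = (z - \<beta>)/(z - \<alpha>)\<close> the map \<open>\<sigma>\<close> is multiplication by \<open>\<alpha>/\<beta>\<close>, so the torus is the
  quotient of the punctured \<open>u\<close>-plane by \<open>u \<mapsto> (\<alpha>/\<beta>) u\<close>, and its modular parameter should be the
  multiplier \<open>\<alpha>/\<beta>\<close>.

  In terms of periods: the form \<open>du/u = (1/(z - \<beta>) - 1/(z - \<alpha>)) dz\<close> lives on the sewn surface, has
  \<open>a\<close>-period \<open>2\<pi>\<i>\<close> because an \<open>a\<close>-cycle encircles \<open>\<beta>\<close> but not \<open>\<alpha>\<close>, and its integral along a
  \<open>b\<close>-cycle is a logarithm of the ratio \<open>\<alpha>/\<beta>\<close> of the values of \<open>u\<close> at the end and at the start. These
  facts are \<open>a_period_fixed_point_form\<close> and \<open>b_period_fixed_point_form\<close>.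

  Every other holomorphic form is a multiple of this one (\<open>holomorphic_form_unique\<close>). As \<open>du/u\<close> has
  no zeros, the quotient of the two forms is a holomorphic function on the compact connected surface,
  and such a function is constant by the maximum modulus principle. The work lies in carrying this
  out on the cut sphere: the maximum may be approached at infinity or attained on one of the sewn
  boundary circles, and the two annuli may have degenerated to circles.

  It remains to recognise \<open>q = \<alpha>/\<beta>\<close> as a value of the Catalan series. One has
  \<open>\<chi> = -\<rho>/w\<^sup>2 = \<alpha>\<beta>/(\<alpha> + \<beta>)\<^sup>2 = q/(1 + q)\<^sup>2\<close>, an equation with the two roots \<open>q\<close> and \<open>1/q\<close>. The
  binomial series of \<open>(1 - 4\<chi>)\<^sup>1\<^sup>/\<^sup>2\<close> gives the closed form of the Catalan series with the principal
  square root, whose real part is nonnegative, and this selects the root of modulus less than 1.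
\<close>

section \<open>The Catalan series\<close>

lemma central_binomial_Suc:
  "Suc n * ((2 * Suc n) choose Suc n) = 2 * (2 * n + 1) * ((2 * n) choose n)"
proof -
  have 1: "Suc n * ((2 * Suc n) choose Suc n) = (2 * Suc n) * ((2 * n + 1) choose n)"
    using Suc_times_binomial_eq[of "2*n+1" n] by (simp add: mult.commute)
  have 2: "(2*n+1) choose n = (2*n+1) choose (Suc n)"
    using binomial_symmetric[of n "2*n+1"] by (simp add: Suc_diff_le)
  have 3: "Suc n * ((2 * n + 1) choose Suc n) = (2 * n + 1) * ((2 * n) choose n)"
    using Suc_times_binomial_eq[of "2*n" n] by (simp add: mult.commute)
  show ?thesis using 1 2 3 by (metis mult.assoc mult.left_commute)
qed

text \<open>
  The coefficients of \<open>(1 - 4x)\<^sup>1\<^sup>/\<^sup>2\<close> beyond the constant one are \<open>-2\<close> times the Catalan numbers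
  \<open>(2n choose n) / (n + 1)\<close>: both sequences obey the same two-term recurrence.
\<close>

lemma half_gbinomial_Suc:
  "((1/2 :: complex) gchoose Suc n) * (-4) ^ Suc n
     = - 2 * (of_nat ((2 * n) choose n) / of_nat (Suc n))"
proof (induction n)
  case 0
  show ?case by simp
next
  case (Suc n)
  define C C' :: complex
    where "C = of_nat ((2 * n) choose n)" and "C' = of_nat ((2 * Suc n) choose Suc n)"
  have "of_nat (Suc n * ((2 * Suc n) choose Suc n))
      = (of_nat (2 * (2 * n + 1) * ((2 * n) choose n)) :: complex)"
    by (simp only: central_binomial_Suc)
  then have C': "of_nat (Suc n) * C' = 2 * (2 * of_nat n + 1) * C"
    unfolding of_nat_mult C_def C'_def by simp
  have n0: "of_nat (Suc n) \<noteq> (0::complex)" "of_nat (Suc (Suc n)) \<noteq> (0::complex)"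
    by (simp_all del: of_nat_Suc)
  have step: "((1/2 :: complex) gchoose Suc (Suc n)) =
      ((1/2) gchoose Suc n) * (1/2 - of_nat (Suc n)) / of_nat (Suc (Suc n))"
    using gbinomial_absorb_comp[of "1/2::complex" "Suc n"]
      gbinomial_absorption[of "Suc n" "1/2::complex"]
    by (metis mult.commute nonzero_mult_div_cancel_left of_nat_neq_0)
  have "((1/2 :: complex) gchoose Suc (Suc n)) * (-4) ^ Suc (Suc n)
     = (((1/2) gchoose Suc n) * (-4) ^ Suc n) * (- 4 * (1/2 - of_nat (Suc n)) / of_nat (Suc (Suc n)))"
    unfolding step using n0 by (simp add: field_simps del: of_nat_Suc)
  also have "\<dots> = - 2 * (2 * (2 * of_nat n + 1) * C / of_nat (Suc n)) / of_nat (Suc (Suc n))"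
  proof -
    have "- 4 * (1/2 - of_nat (Suc n)) = (2 * (2 * of_nat n + 1) :: complex)"
      by (simp add: algebra_simps)
    then show ?thesis
      unfolding Suc C_def[symmetric] by (simp only:) (simp del: of_nat_Suc)
  qed
  also have "2 * (2 * of_nat n + 1) * C / of_nat (Suc n) = C'"
    using n0 C' by (metis nonzero_mult_div_cancel_left)
  finally show ?case
    unfolding C'_def by simp
qed

text \<open>
  The coefficients by which \<^const>\<open>catalan_series\<close> is defined are the Catalan numbers in another guise.
\<close>

lemma catalan_number_alt:
  "1 / of_nat (Suc n) * of_nat ((2 * Suc n) choose (Suc n + 1))
     = (of_nat ((2 * Suc n) choose Suc n) / of_nat (Suc (Suc n)) :: complex)"
proof -
  have "Suc (Suc n) * ((2 * Suc n) choose (Suc n + 1)) = Suc n * ((2 * Suc n) choose Suc n)"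
    using binomial_absorb_comp[of "2 * Suc n" "Suc n"] binomial_absorption[of "Suc n" "2 * Suc n"]
    by simp
  then have "of_nat (Suc (Suc n)) * of_nat ((2 * Suc n) choose (Suc n + 1))
      = (of_nat (Suc n) * of_nat ((2 * Suc n) choose Suc n) :: complex)"
    unfolding of_nat_mult[symmetric] by (simp only:)
  moreover have "of_nat (Suc n) \<noteq> (0::complex)" "of_nat (Suc (Suc n)) \<noteq> (0::complex)"
    by (simp_all del: of_nat_Suc)
  ultimately show ?thesis
    by (simp only: divide_simps) (simp add: mult.commute del: of_nat_Suc binomial_Suc_Suc)
qed

text \<open>
  The left-hand side is the binomial series of the right-hand side: the terms \<open>1 - 2x\<close> are the first
  two, and the factor \<open>-2x\<close> in front of the Catalan series accounts for the others.
\<close>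

lemma catalan_series_csqrt:
  assumes "cmod x < 1/4"
  shows "1 - 2 * x * (1 + catalan_series x) = csqrt (1 - 4 * x)"
proof (cases "x = 0")
  case True then show ?thesis by simp
next
  case False
  define c where "c n = (1/2 gchoose n) * (- 4 * x) ^ n" for n
  define d where "d n = 1 / of_nat (Suc n) * of_nat ((2 * Suc n) choose (Suc n + 1)) * x ^ Suc n" for n
  have "c sums (1 + (- 4 * x)) powr (1/2)"
    unfolding c_def using assms by (intro gen_binomial_complex) (simp add: norm_mult)
  then have "c sums csqrt (1 - 4 * x)"
    by (simp add: csqrt_conv_powr)
  then have "(\<lambda>n. c (n + 2)) sums (csqrt (1 - 4 * x) - (\<Sum>i<2. c i))"
    by (rule sums_split_initial_segment)
  moreover have "(\<Sum>i<2. c i) = 1 - 2 * x"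
    by (simp add: c_def numeral_2_eq_2)
  moreover have "c (n + 2) = - 2 * x * d n" for n
  proof -
    have "c (n + 2) = ((1/2 gchoose Suc (Suc n)) * (-4) ^ Suc (Suc n)) * x ^ Suc (Suc n)"
      unfolding c_def power_mult_distrib by simp
    also have "\<dots> = - 2 * x * d n"
      unfolding half_gbinomial_Suc d_def catalan_number_alt
      by (simp del: of_nat_Suc binomial_Suc_Suc)
    finally show ?thesis .
  qed
  ultimately have "(\<lambda>n. - 2 * x * d n) sums (csqrt (1 - 4 * x) - (1 - 2 * x))"
    by simp
  then have "d sums ((csqrt (1 - 4 * x) - (1 - 2 * x)) / (- 2 * x))"
    by (rule sums_mult_D) (use False in simp)
  then have "catalan_series x = (csqrt (1 - 4 * x) - (1 - 2 * x)) / (- 2 * x)"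
    unfolding catalan_series_def d_def by (rule sums_unique[symmetric])
  then show ?thesis using False by (simp add: field_simps)
qed

text \<open>
  Both \<open>q\<close> and \<open>1/q\<close> solve \<open>x = q/(1 + q)\<^sup>2\<close>, and \<open>1 - 4x\<close> is the square of \<open>(1 - q)/(1 + q)\<close>. For
  \<open>\<bar>q\<bar> < 1\<close> that number has positive real part, so it is the principal root that occurs in
  \<open>catalan_series_csqrt\<close>.
\<close>

lemma catalan_series_inverse:
  assumes x: "cmod x < 1/4" "x = q / (1 + q)\<^sup>2" and q: "cmod q < 1" "q \<noteq> 0"
  shows "catalan_series x = q"
proof -
  have q1: "1 + q \<noteq> 0"
    using q by (metis add.commute add_eq_0_iff norm_minus_cancel norm_one order_less_irrefl)
  define s where "s = (1 - q) / (1 + q)"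
  have "1 - 4 * x = s\<^sup>2"
    using q1 by (simp add: x(2) s_def power_divide divide_simps) algebra
  moreover have "0 < Re s"
  proof -
    have "Re s = (1 - (cmod q)\<^sup>2) / (cmod (1 + q))\<^sup>2"
      unfolding s_def cmod_power2 by (simp add: Re_divide power2_eq_square algebra_simps)
    then show ?thesis
      using q q1 by (simp add: power_less_one_iff abs_square_less_1)
  qed
  ultimately have "csqrt (1 - 4 * x) = s"
    by (simp add: csqrt_square)
  then have "2 * x * (1 + catalan_series x) = 1 - s"
    using catalan_series_csqrt[OF x(1)] by (simp add: algebra_simps)
  also have "1 - s = 2 * x * (1 + q)"
    using q1 by (simp add: x(2) s_def power2_eq_square divide_simps)
  finally show ?thesis
    using q q1 by (simp add: x(2))
qed

section \<open>Maximum modulus on sets reaching to infinity\<close>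

text \<open>
  Janiszewski's theorem makes the complement of the two closed balls connected, since their
  intersection is empty and hence connected. The closed set below lies between that complement and
  its closure.
\<close>

lemma connected_compl_disjoint_balls:
  fixes a b :: complex
  assumes disj: "cball a s \<inter> cball b t = {}"
  shows "connected (- ball a s \<inter> - ball b t)"
proof (rule connected_intermediate_closure)
  have conn: "connected (- cball c u)" for c :: complex and u
    by (rule connected_complement_bounded_convex) auto
  show "connected (- (cball a s \<union> cball b t))"
    unfolding connected_iff_connected_component
  proof (intro ballI)
    fix x y assume x: "x \<in> - (cball a s \<union> cball b t)" and y: "y \<in> - (cball a s \<union> cball b t)"
    show "connected_component (- (cball a s \<union> cball b t)) x y"
    proof (rule Janiszewski)
      show "connected_component (- cball a s) x y" "connected_component (- cball b t) x y"
        using conn x y unfolding connected_iff_connected_component by auto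
    qed (use disj in auto)
  qed
  show "- (cball a s \<union> cball b t) \<subseteq> - ball a s \<inter> - ball b t"
    by auto
  have cl: "closure (- cball c u) = - ball c u" for c :: complex and u
    by (simp add: closure_complement)
  show "- ball a s \<inter> - ball b t \<subseteq> closure (- (cball a s \<union> cball b t))"
  proof
    fix x assume x: "x \<in> - ball a s \<inter> - ball b t"
    have "x \<notin> cball a s \<or> x \<notin> cball b t" using disj by blast
    then show "x \<in> closure (- (cball a s \<union> cball b t))"
    proof
      assume "x \<notin> cball a s"
      then have "x \<in> - cball a s \<inter> closure (- cball b t)" using x cl by auto
      also have "\<dots> \<subseteq> closure (- cball a s \<inter> - cball b t)"
        by (intro open_Int_closure_subset) auto
      finally show ?thesis by (simp only: Compl_Un)
    next
      assume "x \<notin> cball b t"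
      then have "x \<in> - cball b t \<inter> closure (- cball a s)" using x cl by auto
      also have "\<dots> \<subseteq> closure (- cball b t \<inter> - cball a s)"
        by (intro open_Int_closure_subset) auto
      finally show ?thesis by (simp only: Compl_Un Int_commute)
    qed
  qed
qed

text \<open>
  The maximum modulus is attained on a closed neighbourhood of infinity in the sphere, without
  infinity itself: in the coordinate \<open>t = 1/z\<close> a small disc around infinity contributes no value
  larger than those on its boundary circle, which belongs to a compact part of \<open>D\<close>.
\<close>

lemma maximum_modulus_at_infinity:
  fixes D :: "complex set" and F H :: "complex \<Rightarrow> complex"
  assumes "closed D" and "bounded (- D)" and cont: "continuous_on D F"
    and H: "H analytic_on {0}" "\<forall>\<^sub>F t in at 0. F (1 / t) = H t"
  shows "\<exists>p\<in>D. \<forall>z\<in>D. cmod (F z) \<le> cmod (F p)"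
proof -
  obtain e1 where e1: "e1 > 0" "H holomorphic_on ball 0 e1"
    using H(1) by (auto simp: analytic_at_ball)
  obtain e2 where e2: "e2 > 0" "\<And>t. t \<noteq> 0 \<Longrightarrow> cmod t < e2 \<Longrightarrow> F (1 / t) = H t"
    using H(2) by (auto simp: eventually_at)
  obtain R where R: "R > 0" "\<And>z. z \<notin> D \<Longrightarrow> cmod z \<le> R"
    using \<open>bounded (- D)\<close> by (metis ComplI bounded_pos)
  define r where "r = min (min e1 e2) (1 / R) / 2"
  have r: "0 < r" "r < e1" "r < e2" "R < 1 / r"
  proof -
    have m: "0 < min (min e1 e2) (1 / R)" using e1 e2 R by simp
    then show "0 < r" "r < e1" "r < e2" by (auto simp: r_def)
    have "min (min e1 e2) (1 / R) \<le> 1 / R" by simp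
    then have "r < 1 / R" using \<open>0 < r\<close> unfolding r_def by linarith
    then show "R < 1 / r" using \<open>0 < r\<close> R(1) by (simp add: field_simps)
  qed
  have far: "z \<in> D" if "cmod z \<ge> 1 / r" for z
    using R(2)[of z] that r by force
  define K where "K = D \<inter> cball 0 (1 / r)"
  have K: "compact K" "K \<subseteq> D" unfolding K_def using \<open>closed D\<close> by (auto intro: closed_Int_compact)
  have "of_real (1 / r) \<in> K" unfolding K_def using far[of "of_real (1/r)"] r by (auto simp: norm_divide)
  then obtain p where p: "p \<in> K" "\<And>z. z \<in> K \<Longrightarrow> cmod (F z) \<le> cmod (F p)"
    using continuous_attains_sup[OF K(1), of "\<lambda>z. cmod (F z)"] continuous_on_norm[OF continuous_on_subset[OF cont K(2)]]
    by blast
  have "cmod (F z) \<le> cmod (F p)" if z: "z \<in> D" for z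
  proof (cases "z \<in> K")
    case False
    then have big: "1 / r < cmod z" using z by (auto simp: K_def)
    then have z0: "z \<noteq> 0" using r by auto
    have inv: "cmod (1 / z) < r" using big r z0 by (simp add: norm_divide field_simps)
    have hol: "H holomorphic_on cball 0 r"
      by (rule holomorphic_on_subset[OF e1(2)]) (use r in auto)
    have "cmod (H (1 / z)) \<le> cmod (F p)"
    proof (rule maximum_modulus_frontier[where S = "cball 0 r" and f = H])
      show "H holomorphic_on interior (cball 0 r)"
        by (rule holomorphic_on_subset[OF hol]) (rule interior_subset)
      show "continuous_on (closure (cball 0 r)) H"
        using hol by (simp add: holomorphic_on_imp_continuous_on)
      show "bounded (cball (0::complex) r)" by simp
      show "1 / z \<in> cball 0 r" using inv by simp
      fix t :: complex assume "t \<in> frontier (cball 0 r)"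
      then have t: "cmod t = r" using r by simp
      then have "t \<noteq> 0" using r by auto
      then have "H t = F (1 / t)" using e2(2)[of t] t r by simp
      moreover have "1 / t \<in> K" unfolding K_def using far[of "1/t"] t by (simp add: norm_divide)
      ultimately show "cmod (H t) \<le> cmod (F p)" using p by simp
    qed
    moreover have "F z = H (1 / z)" using e2(2)[of "1 / z"] inv r z0 by simp
    ultimately show ?thesis by simp
  qed (use p in blast)
  then show ?thesis using p K by blast
qed

text \<open>
  On a connected set that need not be open, the modulus has to be dominated on a full neighbourhood
  of \<open>p\<close>, points outside \<open>D\<close> included; the open domain for the maximum modulus principle is then the
  component around \<open>D\<close> of an open set on which \<open>F\<close> is holomorphic.
\<close>

lemma closed_connected_maximum_modulus:
  assumes "F analytic_on D" "connected D" "p \<in> D"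
    and "\<forall>\<^sub>F z in nhds p. cmod (F z) \<le> cmod (F p)"
  shows "F constant_on D"
proof -
  obtain U where U: "open U" "D \<subseteq> U" "F holomorphic_on U"
    using assms(1) by (auto simp: analytic_on_holomorphic)
  define C where "C = connected_component_set U p"
  have C: "open C" "connected C" "C \<subseteq> U" "D \<subseteq> C"
    unfolding C_def using U assms
    by (simp_all add: open_connected_component connected_component_subset connected_component_maximal)
  obtain V where V: "open V" "p \<in> V" "\<And>z. z \<in> V \<Longrightarrow> cmod (F z) \<le> cmod (F p)"
    using assms(4) by (auto simp: eventually_nhds)
  have "F constant_on C"
  proof (rule maximum_modulus_principle[where U = "V \<inter> C" and \<xi> = p])
    show "F holomorphic_on C" using U C by (blast intro: holomorphic_on_subset)
  qed (use C V assms in auto)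
  then show ?thesis using C(4) unfolding constant_on_def by blast
qed

text \<open>
  This is what makes degenerate annuli harmless: an identity known on a mere circle spreads to a
  neighbourhood by the identity theorem.
\<close>

lemma analytic_eq_near_circle_point:
  fixes f g :: "complex \<Rightarrow> complex"
  assumes "0 < r" "cmod (p - c) = r" "f analytic_on {p}" "g analytic_on {p}"
    and eq: "\<And>z. cmod (z - c) = r \<Longrightarrow> f z = g z"
  shows "\<forall>\<^sub>F z in nhds p. f z = g z"
proof -
  have "(\<lambda>z. f z - g z) analytic_on {p}" using assms by (intro analytic_intros)
  then obtain e where e: "e > 0" "(\<lambda>z. f z - g z) holomorphic_on ball p e"
    by (auto simp: analytic_at_ball)
  have "p islimpt sphere c r"
  proof (rule connected_imp_perfect)
    show "connected (sphere c r)" by (rule connected_sphere) simp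
    show "p \<in> sphere c r" using assms by (simp add: dist_norm norm_minus_commute)
    fix x
    have "c + of_real r \<in> sphere c r" "c - of_real r \<in> sphere c r" using assms by (auto simp: dist_norm)
    moreover have "c + of_real r \<noteq> c - of_real r" using assms by (simp add: algebra_simps)
    ultimately show "sphere c r \<noteq> {x}" by (metis singletonD)
  qed
  then have lim: "p islimpt sphere c r \<inter> ball p e"
    using e by (intro islimpt_Int_eventually eventually_at_in_open') auto
  have "f z - g z = 0" if "z \<in> ball p e" for z
  proof (rule analytic_continuation[OF e(2) _ _ _ _ lim])
    fix z assume "z \<in> sphere c r \<inter> ball p e"
    then show "f z - g z = 0" using eq[of z] by (auto simp: dist_norm norm_minus_commute)
  qed (use e that in auto)
  then show ?thesis using e by (auto simp: eventually_nhds_metric dist_commute)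
qed

section \<open>The fixed points of the sewing map\<close>

text \<open>
  Here \<open>A\<close> and \<open>B\<close> stand for the moduli of the two fixed points. The hypotheses say that at \<open>B\<close>
  the polynomial \<open>(x - r1) (x - r2)\<close> exceeds \<open>(x - A) (x - B)\<close>, so \<open>B\<close> is not between \<open>r1\<close> and
  \<open>r2\<close>; the sum forbids that it is below both.
\<close>

lemma sum_prod_norm_separation:
  fixes A B r1 r2 :: real
  assumes "0 \<le> A" "A \<le> B" "0 < r1" "0 < r2" "A * B \<le> r1 * r2" "r1 + r2 < A + B"
  shows "r1 < B" "r2 < B"
proof -
  have "0 < B" using assms by linarith
  then have "(r1 + r2) * B < (A + B) * B" using assms by simp
  then have pos: "(B - r1) * (B - r2) > 0"
    using assms(5) by (simp add: algebra_simps)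
  then have "r1 < B \<longleftrightarrow> r2 < B" by (auto simp: zero_less_mult_iff)
  moreover have "r1 < B \<or> r2 < B" using assms by linarith
  ultimately show "r1 < B" "r2 < B" by auto
qed

text \<open>
  The two fixed points of the sewing map enter through their sum and product; the last assumption
  fixes their order. With it, \<open>\<alpha>\<close> is the attracting fixed point of the inverse of \<open>\<sigma>\<close> and \<open>\<beta>\<close> that
  of \<open>\<sigma>\<close>.
\<close>

locale sewn_sphere =
  fixes \<rho> w \<alpha> \<beta> :: complex and r1 r2 :: real
  assumes r1_pos: "r1 > 0" and r2_pos: "r2 > 0"
    and \<rho>_pos: "0 < cmod \<rho>" and \<rho>_le: "cmod \<rho> \<le> r1 * r2"
    and w_gt: "cmod w > r1 + r2"
    and sum_fix: "\<alpha> + \<beta> = w" and prod_fix: "\<alpha> * \<beta> = - \<rho>"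
    and fix_le: "cmod \<alpha> \<le> cmod \<beta>"
begin

abbreviation D :: "complex set" where "D \<equiv> cut_plane \<rho> w r1 r2"
abbreviation \<sigma> :: "complex \<Rightarrow> complex" where "\<sigma> \<equiv> sewing_map \<rho> w"

lemma mem_D: "z \<in> D \<longleftrightarrow> cmod \<rho> / r2 \<le> cmod z \<and> cmod \<rho> / r1 \<le> cmod (z - w)"
  by (auto simp: cut_plane_def)

lemma inner_radius_pos: "0 < cmod \<rho> / r2" "0 < cmod \<rho> / r1"
  using \<rho>_pos r1_pos r2_pos by auto

lemma inner_radius_le: "cmod \<rho> / r2 \<le> r1" "cmod \<rho> / r1 \<le> r2"
  using \<rho>_le r1_pos r2_pos by (auto simp: field_simps)

lemma norm_fixed_prod: "cmod \<alpha> * cmod \<beta> = cmod \<rho>"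
  using prod_fix by (metis norm_minus_cancel norm_mult)

lemma fixed_nonzero: "\<alpha> \<noteq> 0" "\<beta> \<noteq> 0"
  using norm_fixed_prod \<rho>_pos by auto

lemma beta_large: "r1 < cmod \<beta>" "r2 < cmod \<beta>"
proof -
  have "r1 + r2 < cmod \<alpha> + cmod \<beta>"
    using w_gt norm_triangle_ineq[of \<alpha> \<beta>] sum_fix by simp
  then show "r1 < cmod \<beta>" "r2 < cmod \<beta>"
    using sum_prod_norm_separation[of "cmod \<alpha>" "cmod \<beta>" r1 r2] fix_le r1_pos r2_pos
      norm_fixed_prod \<rho>_le by auto
qed

lemma alpha_small: "cmod \<alpha> < cmod \<rho> / r2" "cmod \<alpha> < cmod \<rho> / r1"
  using beta_large fixed_nonzero r1_pos r2_pos
  by (simp_all add: norm_fixed_prod[symmetric] field_simps)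

lemma alpha_less_beta: "cmod \<alpha> < cmod \<beta>"
  using alpha_small(1) inner_radius_le(1) beta_large(1) by linarith

lemma fixed_not_in_D: "\<alpha> \<notin> D" "\<beta> \<notin> D"
proof -
  show "\<alpha> \<notin> D" using alpha_small by (simp add: mem_D)
  have "\<beta> - w = - \<alpha>" by (simp add: sum_fix[symmetric])
  then show "\<beta> \<notin> D" using alpha_small by (simp add: mem_D)
qed

lemma annuli_separated:
  "cmod z \<le> r1 \<Longrightarrow> r2 < cmod (z - w)" "cmod (z - w) \<le> r2 \<Longrightarrow> r1 < cmod z"
  using w_gt norm_triangle_ineq2[of w z] by (auto simp: norm_minus_commute)

lemma annulus1_subset: "annulus1 \<rho> r1 r2 \<subseteq> D"
  using annuli_separated inner_radius_le by (force simp: annulus1_def mem_D)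

lemma annulus2_subset: "annulus2 \<rho> w r1 r2 \<subseteq> D"
  using annuli_separated inner_radius_le by (force simp: annulus2_def mem_D)

lemma zero_not_in_D: "0 \<notin> D"
  using inner_radius_pos(1) unfolding mem_D norm_zero by linarith

lemma norm_sigma: "cmod (\<sigma> z - w) = cmod \<rho> / cmod z"
  by (simp add: sewing_map_def norm_divide)

lemma sigma_annulus1: "z \<in> annulus1 \<rho> r1 r2 \<Longrightarrow> \<sigma> z \<in> annulus2 \<rho> w r1 r2"
  using r1_pos r2_pos inner_radius_pos unfolding annulus1_def annulus2_def mem_Collect_eq norm_sigma
  by (smt (verit) divide_divide_eq_right divide_le_eq divide_left_mono frac_le mult.commute pos_divide_le_eq)

lemma sigma_minus_fixed:
  assumes "z \<noteq> 0"
  shows "\<sigma> z - \<beta> = \<alpha> * (z - \<beta>) / z" "\<sigma> z - \<alpha> = \<beta> * (z - \<alpha>) / z"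
proof -
  have "\<rho> = - (\<alpha> * \<beta>)" using prod_fix by simp
  then show "\<sigma> z - \<beta> = \<alpha> * (z - \<beta>) / z" "\<sigma> z - \<alpha> = \<beta> * (z - \<alpha>) / z"
    using assms by (simp_all add: sewing_map_def sum_fix[symmetric] field_simps)
qed

lemma deriv_sigma:
  assumes "z \<noteq> 0"
  shows "deriv \<sigma> z = \<alpha> * \<beta> / z\<^sup>2"
proof -
  have "(\<sigma> has_field_derivative - \<rho> / z\<^sup>2) (at z)"
    unfolding sewing_map_def using assms
    by (auto intro!: derivative_eq_intros simp: power2_eq_square)
  then show ?thesis using prod_fix by (simp add: DERIV_imp_deriv)
qed

section \<open>An explicit holomorphic form and its periods\<close>

definition fixed_point_form :: "complex \<Rightarrow> complex" where
  "fixed_point_form z = 1 / (z - \<beta>) - 1 / (z - \<alpha>)"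

lemma fixed_point_form_eq:
  assumes "z \<noteq> \<alpha>" "z \<noteq> \<beta>"
  shows "fixed_point_form z = (\<beta> - \<alpha>) / ((z - \<alpha>) * (z - \<beta>))"
  using assms by (simp add: fixed_point_form_def divide_simps)

text \<open>
  The form is \<open>du/u\<close> for \<open>u = (z - \<beta>)/(z - \<alpha>)\<close>, and sewing multiplies \<open>u\<close> by a constant. At infinity
  \<open>u = 1\<close>, so nothing singular happens there; the poles \<open>\<alpha>\<close> and \<open>\<beta>\<close> are in the excised discs.
\<close>

lemma holomorphic_fixed_point_form: "holomorphic_form_on_sewn \<rho> w r1 r2 fixed_point_form"
  unfolding holomorphic_form_on_sewn_def
proof (intro conjI ballI)
  show "fixed_point_form analytic_on D"
    unfolding fixed_point_form_def
    by (intro analytic_intros) (use fixed_not_in_D in auto)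
  define h where "h t = - (\<beta> - \<alpha>) / ((1 - \<alpha> * t) * (1 - \<beta> * t))" for t
  have "h analytic_on {0}"
    unfolding h_def by (intro analytic_intros) auto
  moreover have "\<forall>\<^sub>F t in at 0. h t = - fixed_point_form (1 / t) / t\<^sup>2"
  proof -
    have "\<forall>\<^sub>F t in at 0. t \<noteq> 1 / \<alpha>" "\<forall>\<^sub>F t in at 0. t \<noteq> 1 / \<beta>"
      by (rule eventually_neq_at_within)+
    moreover have "\<forall>\<^sub>F t in at (0::complex). t \<noteq> 0"
      by (rule eventually_neq_at_within)
    ultimately show ?thesis
    proof eventually_elim
      case (elim t)
      then have ne: "1 / t \<noteq> \<alpha>" "1 / t \<noteq> \<beta>" "1 - \<alpha> * t \<noteq> 0" "1 - \<beta> * t \<noteq> 0"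
        using fixed_nonzero by (auto simp: field_simps)
      have "(1 / t - \<alpha>) * (1 / t - \<beta>) * t\<^sup>2 = (1 - \<alpha> * t) * (1 - \<beta> * t)"
        using elim by (simp add: field_simps power2_eq_square)
      then show ?case
        unfolding h_def fixed_point_form_eq[OF ne(1,2)] by (simp add: mult.assoc minus_divide_left)
    qed
  qed
  ultimately show "\<exists>h. h analytic_on {0} \<and> (\<forall>\<^sub>F t in at 0. h t = - fixed_point_form (1 / t) / t\<^sup>2)"
    by blast
  fix z assume z: "z \<in> annulus1 \<rho> r1 r2"
  have "z \<in> D" "\<sigma> z \<in> D" using z annulus1_subset annulus2_subset sigma_annulus1 by auto
  then have ne: "z \<noteq> 0" "z \<noteq> \<alpha>" "z \<noteq> \<beta>" "\<sigma> z \<noteq> \<alpha>" "\<sigma> z \<noteq> \<beta>"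
    using fixed_not_in_D zero_not_in_D by auto
  show "fixed_point_form z = fixed_point_form (\<sigma> z) * deriv \<sigma> z"
    unfolding fixed_point_form_eq[OF ne(2,3)] fixed_point_form_eq[OF ne(4,5)]
      deriv_sigma[OF ne(1)] sigma_minus_fixed[OF ne(1)]
    using ne fixed_nonzero by (simp add: power2_eq_square)
qed

lemma contour_integral_fixed_point_form:
  assumes "valid_path \<gamma>" "path_image \<gamma> \<subseteq> D"
  shows "contour_integral \<gamma> fixed_point_form
    = 2 * of_real pi * \<i> * (winding_number \<gamma> \<beta> - winding_number \<gamma> \<alpha>)"
proof -
  have "\<alpha> \<notin> path_image \<gamma>" "\<beta> \<notin> path_image \<gamma>" using assms fixed_not_in_D by auto
  note hc = has_contour_integral_winding_number[OF assms(1) this(1)]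
    has_contour_integral_winding_number[OF assms(1) this(2)]
  show ?thesis
    unfolding fixed_point_form_def
    using contour_integral_unique[OF has_contour_integral_diff[OF hc(2,1)]]
    by (simp add: algebra_simps)
qed

text \<open>
  The excised disc around \<open>w\<close> contains \<open>\<beta>\<close> and is not met by the \<open>a\<close>-cycle, so \<open>\<beta>\<close> is encircled
  as often as \<open>w\<close>; the convex disc of radius \<open>r2\<close> around \<open>w\<close> contains the cycle and misses \<open>\<alpha>\<close>.
\<close>

lemma a_period_fixed_point_form:
  assumes "a_cycle \<rho> w r1 r2 a"
  shows "contour_integral a fixed_point_form = 2 * of_real pi * \<i>"
proof -
  have a: "valid_path a" "path a" "pathfinish a = pathstart a" "path_image a \<subseteq> annulus2 \<rho> w r1 r2"
    "winding_number a w = 1"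
    using assms by (auto simp: a_cycle_def valid_path_imp_path)
  have "winding_number a \<beta> = winding_number a w"
  proof (rule winding_number_eq[where S = "ball w (cmod \<rho> / r1)"])
    have "w - \<beta> = \<alpha>" by (simp add: sum_fix[symmetric])
    then show "\<beta> \<in> ball w (cmod \<rho> / r1)" using alpha_small by (simp add: dist_norm)
    show "ball w (cmod \<rho> / r1) \<inter> path_image a = {}"
      using a(4) by (force simp: annulus2_def dist_norm norm_minus_commute)
    show "w \<in> ball w (cmod \<rho> / r1)" using inner_radius_pos by simp
  qed (use a in auto)
  moreover have "winding_number a \<alpha> = 0"
  proof (rule winding_number_zero_outside[where s = "cball w r2"])
    have "cmod \<alpha> \<le> r1" using alpha_small(1) inner_radius_le(1) by linarith
    then show "\<alpha> \<notin> cball w r2"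
      using annuli_separated(1)[of \<alpha>] by (simp add: dist_norm norm_minus_commute)
    show "path_image a \<subseteq> cball w r2"
      using a(4) by (auto simp: annulus2_def dist_norm norm_minus_commute)
  qed (use a in auto)
  ultimately show ?thesis
    using contour_integral_fixed_point_form[OF a(1)] a annulus2_subset by auto
qed

text \<open>
  Exponentiated, the winding number of a path around a point \<open>c\<close> is the quotient of \<open>z - c\<close> at its two
  ends. Dividing the quotients for \<open>c = \<beta>\<close> and \<open>c = \<alpha>\<close> leaves the multiplier of \<open>\<sigma>\<close>, whatever path
  is taken.
\<close>

lemma b_period_fixed_point_form:
  assumes "b_cycle \<rho> w r1 r2 b"
  shows "exp (contour_integral b fixed_point_form) = \<alpha> / \<beta>"
proof -
  have b: "valid_path b" "path b" "path_image b \<subseteq> D" "pathstart b \<in> annulus1 \<rho> r1 r2"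
    "pathfinish b = \<sigma> (pathstart b)"
    using assms by (auto simp: b_cycle_def valid_path_imp_path)
  define z where "z = pathstart b"
  have zD: "z \<in> D" using b annulus1_subset by (auto simp: z_def)
  have ne: "z \<noteq> 0" "z \<noteq> \<alpha>" "z \<noteq> \<beta>" using zD fixed_not_in_D zero_not_in_D by auto
  have nin: "\<alpha> \<notin> path_image b" "\<beta> \<notin> path_image b" using b fixed_not_in_D by auto
  let ?E = "\<lambda>c. exp (2 * of_real pi * \<i> * winding_number b c)"
  have "\<sigma> z - \<beta> = ?E \<beta> * (z - \<beta>)" "\<sigma> z - \<alpha> = ?E \<alpha> * (z - \<alpha>)"
    using winding_number_exp_2pi[OF b(2) nin(1)] winding_number_exp_2pi[OF b(2) nin(2)] b(5)
    by (simp_all add: z_def)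
  then have "?E \<beta> = \<alpha> / z" "?E \<alpha> = \<beta> / z"
    unfolding sigma_minus_fixed[OF ne(1)] times_divide_eq_left[symmetric]
    using ne by (simp_all only: mult_right_cancel right_minus_eq simp_thms)
  then show ?thesis
    unfolding contour_integral_fixed_point_form[OF b(1,3)] right_diff_distrib exp_diff
    using ne fixed_nonzero by simp
qed

lemma a_cycle_circlepath: "a_cycle \<rho> w r1 r2 (circlepath w r2)"
  unfolding a_cycle_def annulus2_def using r2_pos inner_radius_le(2)
  by (auto simp: winding_number_circlepath_centre dist_norm norm_minus_commute)

text \<open>
  The straight segment from the circle \<open>\<bar>z\<bar> = r1\<close> towards \<open>w\<close> reaches the excised disc around \<open>w\<close> at
  its nearest point; an arc of that disc's boundary circle then leads to the identified point.
\<close>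

lemma b_cycle_exists: "\<exists>b. b_cycle \<rho> w r1 r2 b"
proof -
  define R where "R = cmod \<rho> / r1"
  have R: "0 < R" "R \<le> r2" using inner_radius_pos inner_radius_le by (auto simp: R_def)
  define d where "d = sgn w"
  have d: "cmod d = 1" "w = of_real (cmod w) * d"
  proof -
    have "w \<noteq> 0" using w_gt r1_pos r2_pos by auto
    then show "cmod d = 1" "w = of_real (cmod w) * d"
      unfolding d_def by (simp add: norm_sgn, simp add: sgn_eq)
  qed
  define z where "z = of_real r1 * d"
  have z: "cmod z = r1" "z \<noteq> 0" using d r1_pos by (auto simp: z_def norm_mult)
  obtain s where s: "- d = exp (\<i> * of_real s)"
    using complex_unimodular_polar[of "- d"] d(1) by (metis cis.code cis_conv_exp norm_minus_cancel)
  have "cmod ((\<rho> / z) / of_real R) = 1"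
    using \<rho>_pos r1_pos z by (simp add: norm_divide norm_mult R_def)
  then obtain t where t: "(\<rho> / z) / of_real R = exp (\<i> * of_real t)"
    using complex_unimodular_polar by (metis cis.code cis_conv_exp)
  let ?b = "linepath z (w - of_real R * d) +++ part_circlepath w R s t"
  have "b_cycle \<rho> w r1 r2 ?b"
    unfolding b_cycle_def
  proof (intro conjI)
    show "valid_path ?b"
      by (intro valid_path_join) (auto simp: s[symmetric])
    have "closed_segment z (w - of_real R * d) \<subseteq> D"
    proof
      fix x assume "x \<in> closed_segment z (w - of_real R * d)"
      then obtain u where u: "0 \<le> u" "u \<le> 1" "x = (1 - u) *\<^sub>R z + u *\<^sub>R (w - of_real R * d)"
        by (auto simp: in_segment)
      define l where "l = (1 - u) * r1 + u * (cmod w - R)"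
      have x: "x = of_real l * d"
        unfolding u(3) l_def z_def by (subst d(2)) (simp add: scaleR_conv_of_real algebra_simps)
      have "r1 \<le> cmod w - R" using w_gt R by linarith
      then have "0 \<le> u * (cmod w - R - r1)" "0 \<le> (1 - u) * (cmod w - R - r1)"
        using u by auto
      then have l: "r1 \<le> l" "l \<le> cmod w - R"
        by (simp_all add: l_def algebra_simps)
      have "x - w = of_real (l - cmod w) * d" unfolding x by (subst d(2)) (simp add: algebra_simps)
      then have "cmod (x - w) = \<bar>l - cmod w\<bar>"
        by (simp only: norm_mult norm_of_real d(1) mult_1_right)
      then have "cmod (x - w) = cmod w - l" using l R by simp
      moreover have "cmod x = l" using l r1_pos d by (simp add: x norm_mult)
      ultimately show "x \<in> D"
        using l inner_radius_le by (auto simp: mem_D R_def)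
    qed
    moreover have "path_image (part_circlepath w R s t) \<subseteq> annulus2 \<rho> w r1 r2"
      using path_image_part_circlepath_subset'[of R w s t] R
      by (force simp: annulus2_def R_def dist_norm norm_minus_commute)
    ultimately show "path_image ?b \<subseteq> D"
      using annulus2_subset by (subst path_image_join) (auto simp: s[symmetric])
    show "pathstart ?b \<in> annulus1 \<rho> r1 r2"
      using z inner_radius_le by (simp add: annulus1_def)
    show "pathfinish ?b = \<sigma> (pathstart ?b)"
      using R by (simp add: t[symmetric] sewing_map_def)
  qed
  then show ?thesis by blast
qed

section \<open>Uniqueness of the holomorphic form\<close>

text \<open>
  A holomorphic function on the compact connected sewn surface is constant. The modulus attains its
  maximum at some \<open>p\<close> in the cut sphere; if \<open>p\<close> is on the boundary circle around \<open>w\<close>, the point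
  identified with it takes its place as \<open>p'\<close>. If \<open>p'\<close> is on the boundary circle around 0, the part of a
  neighbourhood that lies in the excised disc is carried by \<open>\<sigma>\<close> into the cut sphere on the other
  side of the seam, so the maximum is dominated there as well.
\<close>

lemma invariant_function_constant:
  assumes F: "F analytic_on D" and inv: "\<And>z. z \<in> annulus1 \<rho> r1 r2 \<Longrightarrow> F (\<sigma> z) = F z"
    and H: "H analytic_on {0}" "\<forall>\<^sub>F t in at 0. F (1 / t) = H t"
  shows "F constant_on D"
proof -
  have Deq: "D = - ball 0 (cmod \<rho> / r2) \<inter> - ball w (cmod \<rho> / r1)"
    by (auto simp: mem_D dist_norm norm_minus_commute)
  have disj: "cball 0 (cmod \<rho> / r2) \<inter> cball w (cmod \<rho> / r1) = {}"
  proof (rule ccontr)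
    assume "\<not> ?thesis"
    then obtain z where "cmod z \<le> cmod \<rho> / r2" "cmod (z - w) \<le> cmod \<rho> / r1"
      by (auto simp: dist_norm norm_minus_commute)
    then show False using annuli_separated(1)[of z] inner_radius_le by linarith
  qed
  have conn: "connected D"
    unfolding Deq by (rule connected_compl_disjoint_balls[OF disj])
  have "closed D" unfolding Deq by (intro closed_Int) (auto intro: closed_Compl)
  moreover have "bounded (- D)" unfolding Deq by simp
  moreover have "continuous_on D F"
    using F analytic_imp_holomorphic holomorphic_on_imp_continuous_on by blast
  ultimately obtain p where p: "p \<in> D" "\<And>z. z \<in> D \<Longrightarrow> cmod (F z) \<le> cmod (F p)"
    using maximum_modulus_at_infinity[OF _ _ _ H] by blast
  have gap1: "\<forall>\<^sub>F z in nhds x. cmod \<rho> / r1 < cmod (z - w)" if "cmod \<rho> / r1 < cmod (x - w)" for x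
    using that by (intro order_tendstoD(1)[where y = "cmod (x - w)"] tendsto_intros filterlim_ident) auto
  have gap2: "\<forall>\<^sub>F z in nhds x. cmod \<rho> / r2 < cmod z" if "cmod \<rho> / r2 < cmod x" for x :: complex
    using that by (intro order_tendstoD(1)[where y = "cmod x"] tendsto_intros filterlim_ident) auto
  \<comment> \<open>Points of the boundary circle around \<open>w\<close> are images under \<open>\<sigma>\<close> of points with \<open>\<bar>z\<bar> = r1\<close>.\<close>
  obtain p' where p': "p' \<in> D" "cmod \<rho> / r1 < cmod (p' - w)" "cmod (F p') = cmod (F p)"
  proof (cases "cmod \<rho> / r1 < cmod (p - w)")
    case True
    then show thesis using that p by blast
  next
    case False
    then have eq: "cmod (p - w) = cmod \<rho> / r1" using p(1) by (simp add: mem_D)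
    then have pw: "p - w \<noteq> 0" using inner_radius_pos(2) by (metis norm_zero order_less_irrefl)
    define z where "z = \<rho> / (p - w)"
    have "cmod z = r1" using eq \<rho>_pos r1_pos by (simp add: z_def norm_divide)
    then have z: "z \<in> annulus1 \<rho> r1 r2" using inner_radius_le by (simp add: annulus1_def)
    have "\<sigma> z = p" using pw \<rho>_pos by (auto simp: z_def sewing_map_def)
    then have "F z = F p" using inv[OF z] by simp
    moreover have "cmod \<rho> / r1 < cmod (z - w)"
      using annuli_separated(1)[of z] \<open>cmod z = r1\<close> inner_radius_le by linarith
    ultimately show thesis using that z annulus1_subset by auto
  qed
  have "\<forall>\<^sub>F z in nhds p'. cmod (F z) \<le> cmod (F p')"
  proof (cases "cmod \<rho> / r2 < cmod p'")
    case True
    show ?thesis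
      using gap1[OF p'(2)] gap2[OF True]
    proof eventually_elim
      case (elim z)
      then show ?case using p(2)[of z] p'(3) by (simp add: mem_D)
    qed
  next
    case False
    then have eq: "cmod p' = cmod \<rho> / r2" using p'(1) by (simp add: mem_D)
    have circle: "z \<in> annulus1 \<rho> r1 r2" if "cmod z = cmod \<rho> / r2" for z
      using that inner_radius_le by (simp add: annulus1_def)
    have "p' \<noteq> 0" using p' zero_not_in_D by auto
    have \<sigma>_an: "\<sigma> analytic_on {p'}"
      unfolding sewing_map_def using \<open>p' \<noteq> 0\<close> by (intro analytic_intros) auto
    have \<sigma>p: "\<sigma> p' \<in> D" using sigma_annulus1[OF circle[OF eq]] annulus2_subset by blast
    have "(\<lambda>z. F (\<sigma> z)) analytic_on {p'}"
      by (rule analytic_on_compose[OF \<sigma>_an, unfolded o_def]) (use \<sigma>p F analytic_on_subset in auto)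
    moreover have "F analytic_on {p'}" using F p'(1) analytic_on_subset by blast
    ultimately have inv': "\<forall>\<^sub>F z in nhds p'. F z = F (\<sigma> z)"
      using eq inv circle inner_radius_pos(1)
      by (intro analytic_eq_near_circle_point[where c = 0 and r = "cmod \<rho> / r2"]) auto
    have "isCont \<sigma> p'" unfolding sewing_map_def using \<open>p' \<noteq> 0\<close> by (intro continuous_intros) auto
    then have tend: "filterlim \<sigma> (nhds (\<sigma> p')) (nhds p')"
      by (simp add: isCont_def tendsto_at_iff_tendsto_nhds)
    have "cmod (\<sigma> p' - w) = r2" using eq r2_pos \<rho>_pos by (simp add: norm_sigma)
    then have "cmod \<rho> / r2 < cmod (\<sigma> p')"
      using annuli_separated(2)[of "\<sigma> p'"] inner_radius_le(1) by linarith
    from filterlim_iff[THEN iffD1, OF tend, rule_format, OF gap2[OF this]]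
    have "\<forall>\<^sub>F z in nhds p'. cmod \<rho> / r2 < cmod (\<sigma> z)" .
    moreover have "\<forall>\<^sub>F z in nhds p'. z \<noteq> 0"
      using \<open>p' \<noteq> 0\<close> by (intro t1_space_nhds) auto
    ultimately show ?thesis
      using gap1[OF p'(2)] inv'
    proof eventually_elim
      case (elim z)
      show ?case
      proof (cases "cmod \<rho> / r2 \<le> cmod z")
        case True
        then show ?thesis using elim p(2)[of z] p'(3) by (simp add: mem_D)
      next
        case False
        then have "r2 < cmod (\<sigma> z - w)"
          using elim r2_pos by (simp add: norm_sigma field_simps)
        then have "\<sigma> z \<in> D" using elim inner_radius_le(2) by (simp add: mem_D)
        then show ?thesis using elim p(2)[of "\<sigma> z"] p'(3) by simp
      qed
    qed
  qed
  then show ?thesis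
    using closed_connected_maximum_modulus[OF F conn p'(1)] by blast
qed

text \<open>
  The function \<open>g(z) (z - \<alpha>) (z - \<beta>)\<close> is, up to the factor \<open>\<beta> - \<alpha>\<close>, the quotient of the given form
  by the nowhere vanishing form with poles at \<open>\<alpha>\<close> and \<open>\<beta>\<close>.
\<close>

lemma holomorphic_form_unique:
  assumes g: "holomorphic_form_on_sewn \<rho> w r1 r2 g"
  shows "\<exists>c. \<forall>z\<in>D. g z = c * fixed_point_form z"
proof -
  obtain h where an: "g analytic_on D" and h: "h analytic_on {0}"
      "\<forall>\<^sub>F t in at 0. h t = - g (1 / t) / t\<^sup>2"
    and inv: "\<And>z. z \<in> annulus1 \<rho> r1 r2 \<Longrightarrow> g z = g (\<sigma> z) * deriv \<sigma> z"
    using g unfolding holomorphic_form_on_sewn_def by blast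
  define F where "F z = g z * ((z - \<alpha>) * (z - \<beta>))" for z
  define H where "H t = - h t * ((1 - \<alpha> * t) * (1 - \<beta> * t))" for t
  have "F constant_on D"
  proof (rule invariant_function_constant[where H = H])
    show "F analytic_on D" unfolding F_def by (intro analytic_intros an)
    show "H analytic_on {0}" unfolding H_def by (intro analytic_intros h)
    have "\<forall>\<^sub>F t in at (0::complex). t \<noteq> 0" by (rule eventually_neq_at_within)
    with h(2) show "\<forall>\<^sub>F t in at 0. F (1 / t) = H t"
    proof eventually_elim
      case (elim t)
      then show ?case by (simp add: F_def H_def field_simps power2_eq_square)
    qed
    fix z assume z: "z \<in> annulus1 \<rho> r1 r2"
    then have z0: "z \<noteq> 0" using annulus1_subset zero_not_in_D by auto
    show "F (\<sigma> z) = F z"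
      unfolding F_def inv[OF z] deriv_sigma[OF z0] sigma_minus_fixed[OF z0]
      using z0 by (simp add: power2_eq_square)
  qed
  then obtain c where c: "\<And>z. z \<in> D \<Longrightarrow> F z = c" unfolding constant_on_def by blast
  have "\<alpha> \<noteq> \<beta>" using alpha_less_beta by auto
  have "g z = c / (\<beta> - \<alpha>) * fixed_point_form z" if "z \<in> D" for z
  proof -
    have ne: "z \<noteq> \<alpha>" "z \<noteq> \<beta>" using that fixed_not_in_D by auto
    show ?thesis
      unfolding fixed_point_form_eq[OF ne] c[OF that, symmetric] F_def
      using ne \<open>\<alpha> \<noteq> \<beta>\<close> by simp
  qed
  then show ?thesis by blast
qed

section \<open>The modular parameter\<close>

lemma modular_parameter_iff_multiplier:
  "sewn_torus_modular_parameter \<rho> w r1 r2 q \<longleftrightarrow> q = \<alpha> / \<beta>"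
proof
  assume "sewn_torus_modular_parameter \<rho> w r1 r2 q"
  then obtain \<nu> a b where *: "holomorphic_form_on_sewn \<rho> w r1 r2 \<nu>"
      "a_cycle \<rho> w r1 r2 a" "b_cycle \<rho> w r1 r2 b"
      "contour_integral a \<nu> = 2 * of_real pi * \<i>" and q: "q = exp (contour_integral b \<nu>)"
    unfolding sewn_torus_modular_parameter_def sewn_torus_period_def by auto
  obtain c where c: "\<And>z. z \<in> D \<Longrightarrow> \<nu> z = c * fixed_point_form z"
    using holomorphic_form_unique[OF *(1)] by blast
  have scale: "contour_integral \<gamma> \<nu> = c * contour_integral \<gamma> fixed_point_form"
    if "path_image \<gamma> \<subseteq> D" "valid_path \<gamma>" for \<gamma>
  proof -
    have "fixed_point_form contour_integrable_on \<gamma>"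
      unfolding fixed_point_form_def using that fixed_not_in_D
      by (intro contour_integrable_diff contour_integrable_inversediff) auto
    moreover have "contour_integral \<gamma> \<nu> = contour_integral \<gamma> (\<lambda>z. c * fixed_point_form z)"
      using c that by (intro contour_integral_eq) auto
    ultimately show ?thesis by (simp add: contour_integral_lmul)
  qed
  have "c * (2 * of_real pi * \<i>) = 2 * of_real pi * \<i>"
    using scale[of a] *(2,4) a_period_fixed_point_form[OF *(2)] annulus2_subset
    by (auto simp: a_cycle_def)
  then have "c = 1" by simp
  then show "q = \<alpha> / \<beta>"
    using scale[of b] *(3) b_period_fixed_point_form[OF *(3)] by (simp add: q b_cycle_def)
next
  assume q: "q = \<alpha> / \<beta>"
  obtain b where b: "b_cycle \<rho> w r1 r2 b" using b_cycle_exists by blast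
  define \<tau> where "\<tau> = 1 / (2 * of_real pi * \<i>) * contour_integral b fixed_point_form"
  have "sewn_torus_period \<rho> w r1 r2 \<tau>"
    unfolding sewn_torus_period_def \<tau>_def
    using holomorphic_fixed_point_form a_cycle_circlepath b
      a_period_fixed_point_form[OF a_cycle_circlepath] by blast
  moreover have "q = exp (2 * of_real pi * \<i> * \<tau>)"
    using b_period_fixed_point_form[OF b] by (simp add: \<tau>_def q)
  ultimately show "sewn_torus_modular_parameter \<rho> w r1 r2 q"
    unfolding sewn_torus_modular_parameter_def by blast
qed

end

theorem proposition5p13:
  fixes w \<rho> q :: complex and r1 r2 :: real
  assumes "w \<noteq> 0"
    and "r1 > 0" and "r2 > 0"
    and "0 < cmod \<rho>" and "cmod \<rho> \<le> r1 * r2"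
    and "cmod w > r1 + r2"
  shows "sewn_torus_modular_parameter \<rho> w r1 r2 q \<longleftrightarrow> q = catalan_series (- \<rho> / w\<^sup>2)"
proof -
  \<comment> \<open>the roots of \<open>z\<^sup>2 - w z - \<rho>\<close>\<close>
  define s where "s = csqrt (w\<^sup>2 + 4 * \<rho>)"
  define x y where "x = (w - s) / 2" and "y = (w + s) / 2"
  have "x + y = w" by (simp add: x_def y_def field_simps)
  moreover have "x * y = - \<rho>"
  proof -
    have "x * y = (w\<^sup>2 - s\<^sup>2) / 4" by (simp add: x_def y_def power2_eq_square field_simps)
    then show ?thesis by (simp add: s_def)
  qed
  ultimately obtain \<alpha> \<beta> where fixed: "\<alpha> + \<beta> = w" "\<alpha> * \<beta> = - \<rho>" "cmod \<alpha> \<le> cmod \<beta>"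
    using that[of x y] that[of y x] linear[of "cmod x" "cmod y"] by (auto simp: add.commute mult.commute)
  interpret sewn_sphere \<rho> w \<alpha> \<beta> r1 r2
    by unfold_locales (use assms fixed in auto)
  have "4 * cmod \<rho> < (cmod w)\<^sup>2"
  proof -
    have "4 * cmod \<rho> \<le> 4 * (r1 * r2)" using assms by simp
    also have "\<dots> \<le> (r1 + r2)\<^sup>2"
      using zero_le_power2[of "r1 - r2"] by (simp add: power2_eq_square algebra_simps)
    also have "\<dots> < (cmod w)\<^sup>2" using assms by (intro power_strict_mono) auto
    finally show ?thesis .
  qed
  then have "cmod (- \<rho> / w\<^sup>2) < 1 / 4"
    using assms(1) by (simp add: norm_divide norm_power field_simps)
  moreover have "- \<rho> / w\<^sup>2 = (\<alpha> / \<beta>) / (1 + \<alpha> / \<beta>)\<^sup>2"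
  proof -
    have "1 + \<alpha> / \<beta> = w / \<beta>" using fixed fixed_nonzero by (simp add: field_simps)
    then show ?thesis
      unfolding fixed(2)[symmetric] using fixed_nonzero by (simp add: power2_eq_square)
  qed
  moreover have "cmod (\<alpha> / \<beta>) < 1" "\<alpha> / \<beta> \<noteq> 0"
    using alpha_less_beta fixed_nonzero by (simp_all add: norm_divide)
  ultimately have "catalan_series (- \<rho> / w\<^sup>2) = \<alpha> / \<beta>"
    by (rule catalan_series_inverse)
  then show ?thesis
    using modular_parameter_iff_multiplier by simp
qed

end
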